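(* There exists an absolute constant $C$ (independent of $n$ and $k$) such that for all integers $n \ge k \ge 3$, $$\Delta_k(n) \le C\,\frac{\log(k)}{\log(n)}.$$
   Context: For distinct points $A,B,C \in \mathbb{R}^2$, $\angle ABC \in [0^\circ,180^\circ]$ denotes the (unsigned) angle at $B$ between the vectors $\vec{BA}$ and $\vec{BC}$, measured in degrees (collinear triples give $0^\circ$ or $180^\circ$). For integers $n \ge k \ge 3$, define $$\Gamma_k(n) = \sup\{\gamma : \forall\, S \subset \mathbb{R}^2 \text{ with } |S|=n,\ \exists\, T \subseteq S \text{ with } |T|=k \text{ such that } |\angle ABC-90^\circ| \ge \gamma \text{ for all distinct } A,B,C \in T\},$$ and $\Delta_k(n) := 90^\circ - \Gamma_k(n)$. *)

theory Defs
  imports "HOL-Analysis.Analysis"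
begin

(* Unsigned angle at B, in degrees.  It lies in [0, 180] when A and C differ from B;
   the junk value for B = A or B = C (division by zero) is never used below. *)
definition angle_deg :: "real^2 \<Rightarrow> real^2 \<Rightarrow> real^2 \<Rightarrow> real" where
  "angle_deg A B C =
     arccos (((A - B) \<bullet> (C - B)) / (norm (A - B) * norm (C - B))) * 180 / pi"

(* For 3 \<le> k \<le> n the set below contains all nonpositive reals and is bounded above by 90,
   so Sup is a genuine supremum.  For n > 0, "card S = n" entails that S is finite. *)
definition Gamma_angle :: "nat \<Rightarrow> nat \<Rightarrow> real" where
  "Gamma_angle k n = Sup {\<gamma>::real.
     \<forall>S::(real^2) set. card S = n \<longrightarrow>
       (\<exists>T. T \<subseteq> S \<and> card T = k \<and>
         (\<forall>A\<in>T. \<forall>B\<in>T. \<forall>C\<in>T. A \<noteq> B \<and> B \<noteq> C \<and> A \<noteq> C \<longrightarrow>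
            \<bar>angle_deg A B C - 90\<bar> \<ge> \<gamma>))}"

definition Delta_angle :: "nat \<Rightarrow> nat \<Rightarrow> real" where
  "Delta_angle k n = 90 - Gamma_angle k n"

end

theory Submission
  imports Defs
begin

text \<open>
  Split the directions of the plane modulo sign into \<open>m\<close> sectors of angle \<open>\<pi> / m\<close>. Each sector is
  a convex cone, so ``\<open>y - x\<close> lies in the sector'' is a strict partial order, and any two distinct
  points are comparable in one of these \<open>m\<close> orders. Labelling a point by the lengths of the
  longest chains ending in it, as in the Erdos--Szekeres theorem, shows that more than
  \<open>(k - 1) ^ m\<close> points contain a chain of \<open>k\<close> points for one of the orders. All angles of such a
  chain are within \<open>180 / m\<close> degrees of 0 or of 180. Now take \<open>m\<close> to be the integer part of
  \<open>ln n / ln k\<close>.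
\<close>

section \<open>Chains in a family of strict orders\<close>

lemma chain_of_card_if_orders_cover:
  fixes R :: "'i \<Rightarrow> 'a \<Rightarrow> 'a \<Rightarrow> bool"
  assumes "finite S" "finite I"
    and irrefl: "\<And>i x. i \<in> I \<Longrightarrow> \<not> R i x x"
    and trans: "\<And>i x y z. i \<in> I \<Longrightarrow> R i x y \<Longrightarrow> R i y z \<Longrightarrow> R i x z"
    and cover: "\<And>x y. x \<in> S \<Longrightarrow> y \<in> S \<Longrightarrow> x \<noteq> y \<Longrightarrow> \<exists>i\<in>I. R i x y \<or> R i y x"
    and large: "(k - 1) ^ card I < card S"
  shows "\<exists>i\<in>I. \<exists>T\<subseteq>S. card T = k \<and> (\<forall>x\<in>T. \<forall>y\<in>T. x \<noteq> y \<longrightarrow> R i x y \<or> R i y x)"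
proof (rule ccontr)
  assume neg: "\<not> ?thesis"
  define chain where
    "chain i T \<longleftrightarrow> T \<subseteq> S \<and> (\<forall>x\<in>T. \<forall>y\<in>T. x \<noteq> y \<longrightarrow> R i x y \<or> R i y x)" for i T
  have chain_subset: "chain i U" if "chain i T" "U \<subseteq> T" for i T U
    using that unfolding chain_def by (meson subset_eq)
  have chain_card: "card T < k" if "i \<in> I" "chain i T" for i T
  proof (rule ccontr)
    assume "\<not> card T < k"
    then obtain U where U: "U \<subseteq> T" "card U = k"
      by (meson obtain_subset_with_card_n not_less)
    then have "chain i U" using chain_subset that(2) by blast
    then show False using neg that(1) U(2) unfolding chain_def by blast
  qed
  \<comment> \<open>Chains with greatest element \<open>x\<close>: they can be prolonged by any
    point of \<open>S\<close> above \<open>x\<close>, which will make \<open>h i\<close> strictly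
    increasing.\<close>
  define below where
    "below i x = {T. chain i T \<and> x \<in> T \<and> (\<forall>y\<in>T. y \<noteq> x \<longrightarrow> R i y x)}" for i x
  define h where "h i x = Max (card ` below i x)" for i x
  have fin: "finite (card ` below i x)" for i x
    by (rule finite_imageI, rule finite_subset[of _ "Pow S"])
      (auto simp: below_def chain_def \<open>finite S\<close>)
  have single: "{x} \<in> below i x" if "x \<in> S" for i x
    using that by (auto simp: below_def chain_def)
  have h_in: "\<exists>T\<in>below i x. card T = h i x" if "x \<in> S" for i x
  proof -
    have "h i x \<in> card ` below i x"
      unfolding h_def using fin single[OF that] by (intro Max_in) auto
    then show ?thesis by auto
  qed
  have h_ge: "card T \<le> h i x" if "T \<in> below i x" for T i x
    unfolding h_def using fin that by (intro Max_ge) auto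
  have h_less: "h i x < h i y" if "i \<in> I" "x \<in> S" "y \<in> S" "R i x y" for i x y
  proof -
    obtain T where T: "T \<in> below i x" "card T = h i x"
      using h_in[OF \<open>x \<in> S\<close>] by blast
    \<comment> \<open>By transitivity all of \<open>T\<close> lies below \<open>y\<close>;
      irreflexivity then makes \<open>y\<close> a new element, so appending it raises the size by
      one.\<close>
    have below_y: "R i z y" if "z \<in> T" for z
      using that T(1) \<open>R i x y\<close> trans[OF \<open>i \<in> I\<close>] by (cases "z = x") (auto simp: below_def)
    then have "y \<notin> T" using irrefl[OF \<open>i \<in> I\<close>] by blast
    have "insert y T \<in> below i y"
      using below_y T(1) \<open>y \<in> S\<close> by (auto simp: below_def chain_def)
    moreover have "finite T"
      using T(1) \<open>finite S\<close> by (auto simp: below_def chain_def intro: finite_subset)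
    ultimately show ?thesis
      using h_ge[of "insert y T" i y] T(2) \<open>y \<notin> T\<close> by simp
  qed
  \<comment> \<open>The singleton chain gives the lower bound 1, so only \<open>k - 1\<close> values
    remain; this is the base of the power in \<open>large\<close>.\<close>
  have h_range: "h i x \<in> {1..k - 1}" if "i \<in> I" "x \<in> S" for i x
  proof -
    obtain T where "T \<in> below i x" "card T = h i x"
      using h_in[OF \<open>x \<in> S\<close>] by blast
    then have "h i x < k" using chain_card[OF \<open>i \<in> I\<close>, of T] by (simp add: below_def)
    moreover have "1 \<le> h i x" using h_ge[OF single[OF \<open>x \<in> S\<close>]] by simp
    ultimately show ?thesis by simp
  qed
  \<comment> \<open>Restricting to \<open>I\<close> makes labels extensional, so they lie in a
    finite function space with \<open>(k - 1) ^ card I\<close> elements.\<close>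
  define label where "label x = (\<lambda>i\<in>I. h i x)" for x
  have "inj_on label S"
  proof (rule inj_onI, rule ccontr)
    fix x y assume xy: "x \<in> S" "y \<in> S" "label x = label y" "x \<noteq> y"
    \<comment> \<open>Some order compares the two points, and there \<open>h i\<close> must
      differ.\<close>
    then obtain i where i: "i \<in> I" "R i x y \<or> R i y x" using cover by blast
    have "h i x = h i y" using fun_cong[OF xy(3), of i] i(1) by (simp add: label_def)
    then show False using h_less[OF i(1)] xy i(2) by fastforce
  qed
  moreover have "label ` S \<subseteq> I \<rightarrow>\<^sub>E {1..k - 1}"
    using h_range by (auto simp: label_def)
  ultimately have "card S \<le> card (I \<rightarrow>\<^sub>E {1..k - 1})"
    by (intro card_inj_on_le) (auto intro: finite_PiE \<open>finite I\<close>)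
  also have "\<dots> = (k - 1) ^ card I"
    by (simp add: card_PiE \<open>finite I\<close>)
  finally show False using large by simp
qed

section \<open>Sectors of directions in the plane\<close>

text \<open>The planar cross product of the unit vector at angle \<open>a\<close> with
  \<open>v\<close>: it is positive exactly when \<open>v\<close> points to the left of that
  direction.\<close>

definition cross_dir :: "real \<Rightarrow> real^2 \<Rightarrow> real" where
  "cross_dir a v = cos a * v$2 - sin a * v$1"

text \<open>For \<open>0 < w < pi\<close> these are the nonzero vectors with polar angle in the
  half-open interval from \<open>a\<close> to \<open>a + w\<close>. Linear inequalities make closure
  under sums immediate; the strict one excludes 0, which gives irreflexivity.\<close>

definition sector :: "real \<Rightarrow> real \<Rightarrow> real^2 \<Rightarrow> bool" where
  "sector a w v \<longleftrightarrow> 0 \<le> cross_dir a v \<and> cross_dir (a + w) v < 0"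

lemma sector_add: "sector a w u \<Longrightarrow> sector a w v \<Longrightarrow> sector a w (u + v)"
  by (simp add: sector_def cross_dir_def algebra_simps)

lemma not_sector_zero: "\<not> sector a w 0"
  by (simp add: sector_def cross_dir_def)

lemma norm_sq_real2: "(norm (v :: real^2))\<^sup>2 = (v$1)\<^sup>2 + (v$2)\<^sup>2"
  by (simp only: power2_norm_eq_inner) (simp add: inner_vec_def sum_2 power2_eq_square)

lemma sector_polar:
  assumes "sector a w v" "0 \<le> w"
  obtains t where "0 \<le> t" "t \<le> w" "v$1 = norm v * cos (a + t)" "v$2 = norm v * sin (a + t)"
proof -
  have "v \<noteq> 0" using assms not_sector_zero by metis
  then have pos: "norm v > 0" by simp
  \<comment> \<open>Coordinates of the normalized vector in the frame rotated by \<open>a\<close>; a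
    nonnegative \<open>y\<close> puts its angle \<open>t\<close> in that frame between 0 and
    \<open>pi\<close>.\<close>
  define x where "x = (cos a * v$1 + sin a * v$2) / norm v"
  define y where "y = cross_dir a v / norm v"
  have "(cos a * v$1 + sin a * v$2)\<^sup>2 + (cross_dir a v)\<^sup>2
      = ((cos a)\<^sup>2 + (sin a)\<^sup>2) * ((v$1)\<^sup>2 + (v$2)\<^sup>2)"
    unfolding cross_dir_def by algebra
  then have "x\<^sup>2 + y\<^sup>2 = 1"
    using pos by (simp add: x_def y_def power_divide add_divide_distrib[symmetric]
        norm_sq_real2[symmetric])
  moreover have "0 \<le> y" using assms pos by (simp add: y_def sector_def)
  ultimately obtain t where t: "0 \<le> t" "t \<le> pi" "x = cos t" "y = sin t"
    using sincos_total_pi by blast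
  have eqx: "cos a * v$1 + sin a * v$2 = norm v * cos t"
    and eqy: "cos a * v$2 - sin a * v$1 = norm v * sin t"
    using t(3,4) pos by (auto simp: x_def y_def cross_dir_def field_simps)
  have one: "(sin a)\<^sup>2 + (cos a)\<^sup>2 = 1" by simp
  have v1: "v$1 = norm v * cos (a + t)"
    using eqx eqy one unfolding cos_add by algebra
  have v2: "v$2 = norm v * sin (a + t)"
    using eqx eqy one unfolding sin_add by algebra
  \<comment> \<open>The second sector inequality becomes \<open>sin (t - w) < 0\<close>, which is
    impossible for \<open>w < t \<le> pi\<close>.\<close>
  have "cross_dir (a + w) v = norm v * sin ((a + t) - (a + w))"
    unfolding cross_dir_def sin_diff using v1 v2 by (simp add: algebra_simps)
  then have "sin (t - w) < 0"
    using assms(1) pos by (simp add: sector_def mult_less_0_iff)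
  then have "t \<le> w"
    using sin_ge_zero[of "t - w"] t(2) \<open>0 \<le> w\<close> by linarith
  with t(1) v1 v2 show ?thesis using that by blast
qed

lemma sector_arccos_le:
  assumes "sector a w u" "sector a w v" "0 \<le> w" "w \<le> pi"
  shows "arccos ((u \<bullet> v) / (norm u * norm v)) \<le> w"
proof -
  obtain s where s: "0 \<le> s" "s \<le> w" "u$1 = norm u * cos (a + s)" "u$2 = norm u * sin (a + s)"
    using sector_polar assms by metis
  obtain t where t: "0 \<le> t" "t \<le> w" "v$1 = norm v * cos (a + t)" "v$2 = norm v * sin (a + t)"
    using sector_polar assms by metis
  have "u \<bullet> v = norm u * norm v * cos ((a + s) - (a + t))"
    unfolding cos_diff using s t by (simp add: inner_vec_def sum_2 algebra_simps)
  moreover have "norm u \<noteq> 0" "norm v \<noteq> 0"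
    using assms not_sector_zero by auto
  \<comment> \<open>The absolute value moves the angle difference into the range where
    \<open>arccos\<close> inverts \<open>cos\<close>.\<close>
  ultimately have "(u \<bullet> v) / (norm u * norm v) = cos \<bar>s - t\<bar>" by simp
  moreover have "\<bar>s - t\<bar> \<le> w" using s t by linarith
  moreover from this have "arccos (cos \<bar>s - t\<bar>) = \<bar>s - t\<bar>"
    using assms(4) by (intro arccos_cos) auto
  ultimately show ?thesis by simp
qed

text \<open>Up to sign, \<open>v\<close> has polar angle in \<open>[0, pi)\<close>; turning the test
  direction from 0 to \<open>pi\<close> in steps of \<open>pi / m\<close>, the first sign change of
  the cross product locates the sector. For \<open>m = 1\<close> horizontal vectors would be missed,
  since both cross products vanish.\<close>

lemma sector_cover:
  fixes m :: nat
  assumes "v \<noteq> 0" "2 \<le> m"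
  shows "\<exists>i<m. sector (real i * (pi / m)) (pi / m) v \<or> sector (real i * (pi / m)) (pi / m) (- v)"
proof -
  have upper: "\<exists>i<m. sector (real i * (pi / m)) (pi / m) u"
    if u: "0 < u$2 \<or> u$2 = 0 \<and> 0 < u$1" for u :: "real^2"
  proof -
    define f where "f i = cross_dir (real i * (pi / m)) u" for i
    \<comment> \<open>Direction \<open>pi\<close> reverses the sign of \<open>u$2\<close>; on the
      positive horizontal axis the first step already gives a negative value.\<close>
    have "\<exists>j\<le>m. f j < 0"
    proof (cases "0 < u$2")
      case True
      then show ?thesis using \<open>2 \<le> m\<close> by (intro exI[of _ m]) (simp add: f_def cross_dir_def)
    next
      case False
      have "0 < sin (pi / m)" using \<open>2 \<le> m\<close> by (intro sin_gt_zero) (auto simp: field_simps)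
      with False u show ?thesis
        using \<open>2 \<le> m\<close> by (intro exI[of _ 1]) (simp add: f_def cross_dir_def)
    qed
    then obtain j where j: "j \<le> m" "f j < 0" by blast
    have "\<not> f 0 < 0" using u by (auto simp: f_def cross_dir_def)
    with j obtain i where i: "i < j" "\<forall>l\<le>i. \<not> f l < 0" "f (Suc i) < 0"
      using ex_least_nat_less[of "\<lambda>i. f i < 0" j] by blast
    then have "sector (real i * (pi / m)) (pi / m) u"
      by (auto simp: sector_def f_def algebra_simps not_less add_divide_distrib)
    with i(1) j(1) show ?thesis by (intro exI[of _ i]) auto
  qed
  have "v$1 \<noteq> 0 \<or> v$2 \<noteq> 0"
    using assms(1) by (auto simp: vec_eq_iff forall_2)
  then have "(0 < v$2 \<or> v$2 = 0 \<and> 0 < v$1) \<or> (0 < (- v)$2 \<or> (- v)$2 = 0 \<and> 0 < (- v)$1)"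
    by auto
  then show ?thesis using upper[of v] upper[of "- v"] by blast
qed

section \<open>From sectors to angles in degrees\<close>

lemma cosine_bounds:
  fixes u v :: "'a::real_inner"
  shows "- 1 \<le> (u \<bullet> v) / (norm u * norm v)" "(u \<bullet> v) / (norm u * norm v) \<le> 1"
proof -
  have "\<bar>(u \<bullet> v) / (norm u * norm v)\<bar> \<le> 1"
    using Cauchy_Schwarz_ineq2[of u v]
    by (simp add: abs_mult divide_le_eq zero_less_mult_iff)
  then show "- 1 \<le> (u \<bullet> v) / (norm u * norm v)" "(u \<bullet> v) / (norm u * norm v) \<le> 1"
    by linarith+
qed

lemma angle_deg_bounds: "0 \<le> angle_deg A B C" "angle_deg A B C \<le> 180"
proof -
  let ?x = "arccos (((A - B) \<bullet> (C - B)) / (norm (A - B) * norm (C - B)))"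
  have "0 \<le> ?x" "?x \<le> pi"
    using arccos_lbound arccos_ubound cosine_bounds by blast+
  then show "0 \<le> angle_deg A B C" "angle_deg A B C \<le> 180"
    by (auto simp: angle_deg_def field_simps)
qed

text \<open>Reversing one of the two vectors turns an angle into its supplement, so the angle at
  \<open>B\<close> is within \<open>w\<close> of 0 or of \<open>pi\<close>, according to whether
  \<open>A\<close> and \<open>C\<close> lie on the same side of \<open>B\<close> in the
  order.\<close>

lemma angle_deg_far_from_right:
  assumes A: "sector a w (A - B) \<or> sector a w (B - A)"
    and C: "sector a w (C - B) \<or> sector a w (B - C)"
    and w: "0 \<le> w" "w \<le> pi"
  shows "90 - w * 180 / pi \<le> \<bar>angle_deg A B C - 90\<bar>"
proof -
  define q where "q = ((A - B) \<bullet> (C - B)) / (norm (A - B) * norm (C - B))"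
  have q: "- 1 \<le> q" "q \<le> 1" unfolding q_def by (rule cosine_bounds)+
  have flip: "((B - A) \<bullet> (C - B)) / (norm (B - A) * norm (C - B)) = - q"
    "((A - B) \<bullet> (B - C)) / (norm (A - B) * norm (B - C)) = - q"
    "((B - A) \<bullet> (B - C)) / (norm (B - A) * norm (B - C)) = q"
    unfolding q_def minus_diff_eq[of A B, symmetric] minus_diff_eq[of C B, symmetric]
    by (simp_all only: norm_minus_cancel inner_minus_left inner_minus_right minus_divide_left
        minus_minus)
  have "arccos q \<le> w \<or> arccos (- q) \<le> w"
    using A C sector_arccos_le[OF _ _ w] flip unfolding q_def by metis
  then have "arccos q \<le> w \<or> pi - w \<le> arccos q"
    using arccos_minus[OF q] by auto
  moreover have "180 - w * 180 / pi = (pi - w) * 180 / pi"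
    by (simp add: left_diff_distrib diff_divide_distrib)
  ultimately have "arccos q * 180 / pi \<le> w * 180 / pi \<or> 180 - w * 180 / pi \<le> arccos q * 180 / pi"
    by (auto simp: divide_le_cancel)
  then show ?thesis unfolding angle_deg_def q_def[symmetric] by linarith
qed

lemma subset_avoiding_right_angles:
  fixes S :: "(real^2) set"
  assumes "card S = n" "k ^ m \<le> n" "1 \<le> m" "3 \<le> k"
  shows "\<exists>T\<subseteq>S. card T = k \<and> (\<forall>A\<in>T. \<forall>B\<in>T. \<forall>C\<in>T. A \<noteq> B \<and> B \<noteq> C \<and> A \<noteq> C \<longrightarrow>
            90 - 180 / real m \<le> \<bar>angle_deg A B C - 90\<bar>)"
proof (cases "m = 1")
  \<comment> \<open>Here the bound is \<open>-90\<close>, so any \<open>k\<close> points will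
    do.\<close>
  case True
  then obtain T where "T \<subseteq> S" "card T = k"
    using assms obtain_subset_with_card_n[of k S] by auto
  with True show ?thesis by (intro exI[of _ T]) auto
next
  case False
  then have m: "2 \<le> m" using assms by simp
  let ?w = "pi / real m"
  define R where "R i x y = sector (real i * ?w) ?w (y - x)" for i x y
  \<comment> \<open>The chain lemma needs strictly more than \<open>(k - 1) ^ m\<close> points, so
    \<open>k ^ m\<close> suffice.\<close>
  have "(k - 1) ^ m < k ^ m" using assms by (intro power_strict_mono) auto
  then have "(k - 1) ^ card {..<m} < card S" using assms by simp
  moreover from this have "finite S" by (intro card_ge_0_finite) linarith
  moreover have "R i x z" if "R i x y" "R i y z" for i x y z
    using sector_add[OF that[unfolded R_def]] by (simp add: R_def)
  moreover have "\<exists>i\<in>{..<m}. R i x y \<or> R i y x" if "x \<noteq> y" for x y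
    using sector_cover[of "y - x" m] that m by (simp add: R_def Bex_def)
  moreover have "\<not> R i x x" for i x
    by (simp add: R_def not_sector_zero)
  ultimately have "\<exists>i\<in>{..<m}. \<exists>T\<subseteq>S. card T = k \<and>
      (\<forall>x\<in>T. \<forall>y\<in>T. x \<noteq> y \<longrightarrow> R i x y \<or> R i y x)"
    by (intro chain_of_card_if_orders_cover) blast+
  then obtain i T where T: "T \<subseteq> S" "card T = k"
    "\<And>x y. x \<in> T \<Longrightarrow> y \<in> T \<Longrightarrow> x \<noteq> y \<Longrightarrow> R i x y \<or> R i y x"
    by blast
  have "90 - 180 / real m \<le> \<bar>angle_deg A B C - 90\<bar>"
    if "A \<in> T" "B \<in> T" "C \<in> T" "A \<noteq> B" "B \<noteq> C" for A B C
  proof -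
    have "90 - ?w * 180 / pi \<le> \<bar>angle_deg A B C - 90\<bar>"
      using T(3)[of A B] T(3)[of C B] that m
      by (intro angle_deg_far_from_right[of "real i * ?w"]) (auto simp: R_def field_simps)
    then show ?thesis by simp
  qed
  with T(1,2) show ?thesis by blast
qed

section \<open>The supremum and the logarithmic bound\<close>

lemma Gamma_angle_ge:
  assumes k: "3 \<le> k" "k \<le> n"
    and g: "\<And>S :: (real^2) set. card S = n \<Longrightarrow>
      \<exists>T\<subseteq>S. card T = k \<and> (\<forall>A\<in>T. \<forall>B\<in>T. \<forall>C\<in>T. A \<noteq> B \<and> B \<noteq> C \<and> A \<noteq> C \<longrightarrow>
        g \<le> \<bar>angle_deg A B C - 90\<bar>)"
  shows "g \<le> Gamma_angle k n"
  unfolding Gamma_angle_def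
proof (rule cSup_upper)
  show "g \<in> {\<gamma>. \<forall>S::(real^2) set. card S = n \<longrightarrow> (\<exists>T. T \<subseteq> S \<and> card T = k \<and>
         (\<forall>A\<in>T. \<forall>B\<in>T. \<forall>C\<in>T. A \<noteq> B \<and> B \<noteq> C \<and> A \<noteq> C \<longrightarrow> \<bar>angle_deg A B C - 90\<bar> \<ge> \<gamma>))}"
    using g by simp
  \<comment> \<open>A set of \<open>n\<close> points must exist, as otherwise every real would be
    admissible and the supremum meaningless.\<close>
  obtain S :: "(real^2) set" where S: "card S = n"
    using infinite_arbitrarily_large[OF infinite_UNIV_char_0] by metis
  show "bdd_above {\<gamma>. \<forall>S::(real^2) set. card S = n \<longrightarrow> (\<exists>T. T \<subseteq> S \<and> card T = k \<and>
         (\<forall>A\<in>T. \<forall>B\<in>T. \<forall>C\<in>T. A \<noteq> B \<and> B \<noteq> C \<and> A \<noteq> C \<longrightarrow> \<bar>angle_deg A B C - 90\<bar> \<ge> \<gamma>))}"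
  proof (rule bdd_aboveI[of _ 90], clarify)
    fix \<gamma>
    assume "\<forall>S::(real^2) set. card S = n \<longrightarrow> (\<exists>T. T \<subseteq> S \<and> card T = k \<and>
         (\<forall>A\<in>T. \<forall>B\<in>T. \<forall>C\<in>T. A \<noteq> B \<and> B \<noteq> C \<and> A \<noteq> C \<longrightarrow> \<bar>angle_deg A B C - 90\<bar> \<ge> \<gamma>))"
    with S obtain T where T: "card T = k" "\<And>A B C. A \<in> T \<Longrightarrow> B \<in> T \<Longrightarrow> C \<in> T \<Longrightarrow>
        A \<noteq> B \<and> B \<noteq> C \<and> A \<noteq> C \<Longrightarrow> \<gamma> \<le> \<bar>angle_deg A B C - 90\<bar>"
      by metis
    \<comment> \<open>Three distinct points give an actual angle, whose distance from 90 is at most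
      90.\<close>
    obtain U where "U \<subseteq> T" "card U = 3"
      using obtain_subset_with_card_n[of 3 T] T(1) k by metis
    then obtain A B C where "A \<in> T" "B \<in> T" "C \<in> T" "A \<noteq> B" "B \<noteq> C" "A \<noteq> C"
      by (auto simp: card_3_iff)
    then have "\<gamma> \<le> \<bar>angle_deg A B C - 90\<bar>" using T(2) by blast
    then show "\<gamma> \<le> 90" using angle_deg_bounds[of A B C] by linarith
  qed
qed

theorem proposition3p1:
  shows "\<exists>C::real. \<forall>n k::nat. 3 \<le> k \<and> k \<le> n \<longrightarrow>
           Delta_angle k n \<le> C * (ln (real k) / ln (real n))"
\<comment> \<open>The sectors give \<open>180 / m\<close>; rounding \<open>L\<close> down to
  \<open>m\<close> costs at most a factor 2, as \<open>L \<ge> 1\<close>.\<close>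
proof (intro exI[of _ 360] allI impI)
  fix n k :: nat
  assume "3 \<le> k \<and> k \<le> n"
  then have k: "3 \<le> k" "k \<le> n" by auto
  \<comment> \<open>\<open>L\<close> is the logarithm of \<open>n\<close> to base \<open>k\<close>,
    so \<open>m\<close> is the largest exponent with \<open>k ^ m \<le> n\<close>.\<close>
  define L where "L = ln (real n) / ln (real k)"
  define m where "m = nat \<lfloor>L\<rfloor>"
  have lnk: "0 < ln (real k)" using k by simp
  have "1 \<le> L" using k lnk by (simp add: L_def le_divide_eq)
  then have m: "1 \<le> m" "real m \<le> L" "L < real m + 1" unfolding m_def by linarith+
  have "ln (real k ^ m) = real m * ln (real k)" using k by (simp add: ln_realpow)
  also have "\<dots> \<le> ln (real n)" using m(2) lnk by (simp add: L_def le_divide_eq)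
  finally have "real k ^ m \<le> real n" using k by simp
  then have "k ^ m \<le> n" by (simp flip: of_nat_power)
  then have "90 - 180 / real m \<le> Gamma_angle k n"
    using k m(1) by (intro Gamma_angle_ge subset_avoiding_right_angles) auto
  then have "Delta_angle k n \<le> 180 / real m" by (simp add: Delta_angle_def)
  also have "\<dots> \<le> 360 / L"
  proof -
    have "1 \<le> real m" using m(1) by simp
    then have "L \<le> 2 * real m" using m(3) by linarith
    then show ?thesis using m(1) \<open>1 \<le> L\<close> by (simp add: field_simps)
  qed
  also have "\<dots> = 360 * (ln (real k) / ln (real n))" by (simp add: L_def)
  finally show "Delta_angle k n \<le> 360 * (ln (real k) / ln (real n))" .
qed

end
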